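(* Let $n\ge 1$ and $h\ge n$ be integers. In the $h$-RO-SP with $n$ online candidates, Algorithm 3 (which for $h\ge n$ has $q=0$ and operates as follows: at each round $\ell$, with $T_{\ell-1}=H\cup\{c_1,\dots,c_{\ell-1}\}$, draw a subset $X_\ell\subseteq T_{\ell-1}$ of cardinality $n-1$ uniformly at random, and accept $c_\ell$ and terminate iff $c_\ell>\max X_\ell$) is $\left(1-\left(1-\frac1n\right)^n\right)$-competitive.
   Context: The random-order secretary problem with a sample of size $h$ ($h$-RO-SP), for integers $n\ge 1$, $h\ge 0$: an adversary picks a set $C$ of $n+h$ candidates with values in $\mathbb{R}_{\ge 0}$ (totally ordered by value, ties broken by a fixed consistent tie-breaker). A subset $H\subseteq C$ of cardinality $h$ (history set) is drawn uniformly at random and given to the online player upfront (together with $n$); the candidates of $O=C\setminus H$ are then presented one by one in a uniformly random order $c_1,\dots,c_n$; after each arrival the player must irrevocably accept or reject it, and accepting terminates. $\mathrm{ALG}$ is the value of the accepted candidate (0 if none), $\mathrm{OPT}=\max O$; an algorithm is $c$-competitive if $\mathbb{E}[\mathrm{ALG}]\ge c\,\mathbb{E}[\mathrm{OPT}]$ for every $C$, expectation over $H$, the random order, and the algorithm's randomness. *)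

theory Defs
  imports "HOL-Probability.Probability" "HOL-Combinatorics.Multiset_Permutations"
begin

text \<open>
  A candidate carries its value and a label; the label plays the role of the tie-breaker. Candidates
  are compared by value, and candidates of equal value by label. Every finite set of valued
  candidates with a total order consistent with the values arises in this way: label each
  candidate by its rank.
\<close>

datatype 'l candidate = Candidate (val: real) (label: 'l)

instantiation candidate :: (linorder) linorder
begin

definition less_candidate :: "'a candidate \<Rightarrow> 'a candidate \<Rightarrow> bool" where
  "c < d \<longleftrightarrow> val c < val d \<or> (val c = val d \<and> label c < label d)"

definition less_eq_candidate :: "'a candidate \<Rightarrow> 'a candidate \<Rightarrow> bool" where
  "c \<le> d \<longleftrightarrow> val c < val d \<or> (val c = val d \<and> label c \<le> label d)"

instance
  by standard
     (auto simp: less_candidate_def less_eq_candidate_def intro: candidate.expand)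

end

text \<open>
  A randomized online algorithm maps the number \<open>n\<close> of online candidates, the history set, the list
  of candidates rejected so far (in order of arrival) and the current candidate to a distribution
  over decisions, where \<open>True\<close> means accept. Its random choices in distinct rounds are independent.
\<close>

type_synonym 'l online_algorithm =
  "nat \<Rightarrow> 'l candidate set \<Rightarrow> 'l candidate list \<Rightarrow> 'l candidate \<Rightarrow> bool pmf"

primrec run_from ::
  "'l online_algorithm \<Rightarrow> nat \<Rightarrow> 'l candidate set \<Rightarrow> 'l candidate list \<Rightarrow> 'l candidate list
     \<Rightarrow> 'l candidate option pmf" where
  "run_from A n H past [] = return_pmf None"
| "run_from A n H past (c # cs) =
     bind_pmf (A n H past c)
       (\<lambda>accept. if accept then return_pmf (Some c) else run_from A n H (past @ [c]) cs)"

definition history_pmf :: "nat \<Rightarrow> 'l candidate set \<Rightarrow> 'l candidate set pmf" where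
  "history_pmf h C = pmf_of_set {H. H \<subseteq> C \<and> card H = h}"

definition outcome_pmf ::
  "'l online_algorithm \<Rightarrow> nat \<Rightarrow> nat \<Rightarrow> 'l candidate set \<Rightarrow> 'l candidate option pmf" where
  "outcome_pmf A n h C =
     bind_pmf (history_pmf h C) (\<lambda>H.
     bind_pmf (pmf_of_set (permutations_of_set (C - H))) (\<lambda>cs.
     run_from A n H [] cs))"

definition expected_ALG :: "'l online_algorithm \<Rightarrow> nat \<Rightarrow> nat \<Rightarrow> 'l candidate set \<Rightarrow> real" where
  "expected_ALG A n h C =
     measure_pmf.expectation (outcome_pmf A n h C) (case_option 0 val)"

definition expected_OPT :: "nat \<Rightarrow> 'l candidate set \<Rightarrow> real" where
  "expected_OPT h C = measure_pmf.expectation (history_pmf h C) (\<lambda>H. Max (val ` (C - H)))"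

definition competitive :: "nat \<Rightarrow> nat \<Rightarrow> real \<Rightarrow> 'l online_algorithm \<Rightarrow> bool" where
  "competitive n h \<rho> A \<longleftrightarrow>
     (\<forall>C. finite C \<and> card C = n + h \<and> (\<forall>c\<in>C. 0 \<le> val c) \<longrightarrow>
        expected_ALG A n h C \<ge> \<rho> * expected_OPT h C)"

text \<open>
  The sampling algorithm in the regime \<open>h \<ge> n\<close>, where no initial rounds are skipped (\<open>q = 0\<close>).
  A candidate beats the maximum of the empty sample, which is only drawn when \<open>n = 1\<close>.
\<close>

definition algorithm3 :: "('l::linorder) online_algorithm" where
  "algorithm3 n H past c =
     map_pmf (\<lambda>X. X = {} \<or> c > Max X)
       (pmf_of_set {X. X \<subseteq> H \<union> set past \<and> card X = n - 1})"

end

theory Submission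
  imports Defs
begin

text \<open>
  Write \<open>T\<close> for the set of the history and the candidates seen up to and including round \<open>l\<close>. Given
  \<open>T\<close>, the current candidate together with the sample is a uniformly random \<open>n\<close>-subset of \<open>T\<close>, and the
  candidate is accepted iff it is the maximum of this subset. Hence each round accepts with
  conditional probability \<open>1/n\<close>, independently of the previous rounds, and contributes, if it is
  reached, \<open>1/n\<close> times the expected maximum of a random \<open>n\<close>-subset, which is the expected optimum.
  So the ratio is exactly the geometric sum of \<open>(1 - 1/n)^(l-1) / n\<close>. The induction removes the last
  arriving candidate; it works with sums over all runs, of which there are \<open>card S! / h!\<close>.
\<close>

lemma card_Diff_finite_subset: "finite S \<Longrightarrow> Y \<subseteq> S \<Longrightarrow> card (S - Y) = card S - card Y"
  by (simp add: card_Diff_subset finite_subset)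

section \<open>Expected payoff of one run with fixed history and arrival order\<close>

lemma finite_set_run_from: "finite (set_pmf (run_from A n H past cs))"
  by (induction cs arbitrary: past) (auto simp: set_bind_pmf)

lemma expectation_bool_pmf:
  fixes f :: "bool \<Rightarrow> real"
  shows "measure_pmf.expectation p f = pmf p True * f True + (1 - pmf p True) * f False"
proof -
  have "measure_pmf.expectation p f = (\<Sum>b\<in>UNIV. pmf p b * f b)"
    by (subst integral_measure_pmf_real[of UNIV]) (auto simp: mult.commute)
  moreover have "pmf p False = 1 - pmf p True"
    using pmf_False_conv_True by blast
  ultimately show ?thesis
    by (simp add: UNIV_bool)
qed

lemma expectation_run_from_Cons:
  fixes f :: "'l candidate option \<Rightarrow> real"
  shows "measure_pmf.expectation (run_from A n H past (c # cs)) f =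
    pmf (A n H past c) True * f (Some c)
    + (1 - pmf (A n H past c) True)
      * measure_pmf.expectation (run_from A n H (past @ [c]) cs) f"
proof -
  have "measure_pmf.expectation (run_from A n H past (c # cs)) f =
    measure_pmf.expectation (A n H past c) (\<lambda>accept. measure_pmf.expectation
      (if accept then return_pmf (Some c) else run_from A n H (past @ [c]) cs) f)"
    unfolding run_from.simps
    by (subst pmf_expectation_bind[of UNIV])
       (auto simp: finite_set_run_from integral_measure_pmf_real[of UNIV] mult.commute)
  then show ?thesis
    by (simp add: expectation_bool_pmf)
qed

lemma pmf_run_from_None:
  "pmf (run_from A n H past cs) None =
     measure_pmf.expectation (run_from A n H past cs) (indicator {None})"
  by (simp add: measure_pmf_single)

text \<open>\<open>run_from\<close> recurses at the front, where the first decision affects all that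
  follows. At the end the dependence is simple: the last candidate matters only if all earlier ones
  were rejected, and then accepting it replaces \<open>f None\<close> by \<open>f (Some c)\<close>.
  The payoff \<open>f\<close> stays general so that \<open>indicator {None}\<close> yields the
  survival probability and \<open>case_option 0 val\<close> the collected value.\<close>

lemma expectation_run_from_snoc:
  fixes f :: "'l candidate option \<Rightarrow> real"
  shows "measure_pmf.expectation (run_from A n H past (cs @ [c])) f =
    measure_pmf.expectation (run_from A n H past cs) f
    + pmf (run_from A n H past cs) None * pmf (A n H (past @ cs) c) True * (f (Some c) - f None)"
proof (induction cs arbitrary: past)
  case Nil
  show ?case
    unfolding append_Nil expectation_run_from_Cons by (simp add: algebra_simps)
next
  case (Cons d cs)
  show ?case
    unfolding append_Cons expectation_run_from_Cons pmf_run_from_None Cons.IH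
    by (simp add: algebra_simps)
qed

section \<open>Summation over all histories and arrival orders\<close>

definition history_arrivals :: "nat \<Rightarrow> 'a set \<Rightarrow> ('a set \<times> 'a list) set" where
  "history_arrivals h S = (SIGMA H:{H. H \<subseteq> S \<and> card H = h}. permutations_of_set (S - H))"

lemma history_arrivals_self:
  assumes "finite S"
  shows "history_arrivals (card S) S = {(S, [])}"
proof -
  have "{H. H \<subseteq> S \<and> card H = card S} = {S}"
    using card_subset_eq[OF assms] by auto
  then show ?thesis
    by (auto simp: history_arrivals_def)
qed

text \<open>Classifies the runs by their last arrival \<open>c\<close>; deleting it leaves an
  arbitrary run on \<open>S - {c}\<close>. The bound \<open>h < card S\<close> makes every arrival
  list nonempty, so that a last arrival exists.\<close>

lemma sum_history_arrivals_snoc: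
  assumes "finite S" and "h < card S"
  shows "(\<Sum>(H, cs)\<in>history_arrivals h S. g H cs) =
    (\<Sum>c\<in>S. \<Sum>(H, cs)\<in>history_arrivals h (S - {c}). g H (cs @ [c]))"
proof -
  have fin: "finite (history_arrivals h T)" if "finite T" for T :: "'a set"
    using that by (auto simp: history_arrivals_def)
  have ne: "cs \<noteq> []" if "(H, cs) \<in> history_arrivals h S" for H cs
    using that assms by (auto simp: history_arrivals_def permutations_of_set_def)
  have "(\<Sum>c\<in>S. \<Sum>(H, cs)\<in>history_arrivals h (S - {c}). g H (cs @ [c])) =
    (\<Sum>(c, H, cs)\<in>(SIGMA c:S. history_arrivals h (S - {c})). g H (cs @ [c]))"
    using assms fin by (subst sum.Sigma) (auto simp: split_def)
  also have "\<dots> = (\<Sum>(H, cs)\<in>history_arrivals h S. g H cs)"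
  proof (rule sum.reindex_bij_witness[of _ "\<lambda>(H, cs). (last cs, H, butlast cs)"
        "\<lambda>(c, H, cs). (H, cs @ [c])"])
    fix a assume a: "a \<in> history_arrivals h S"
    obtain H cs where [simp]: "a = (H, cs)" by (cases a)
    obtain ds c where [simp]: "cs = ds @ [c]"
      using ne a by (metis \<open>a = (H, cs)\<close> append_butlast_last_id)
    show "(case case a of (H, cs) \<Rightarrow> (last cs, H, butlast cs) of (c, H, cs) \<Rightarrow> (H, cs @ [c])) = a"
      by simp
    show "(case a of (H, cs) \<Rightarrow> (last cs, H, butlast cs)) \<in> (SIGMA c:S. history_arrivals h (S - {c}))"
      using a by (auto simp: history_arrivals_def permutations_of_set_def)
  next
    fix b assume b: "b \<in> (SIGMA c:S. history_arrivals h (S - {c}))"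
    obtain c H cs where [simp]: "b = (c, H, cs)" by (cases b)
    have *: "c \<in> S" "H \<subseteq> S - {c}" "card H = h" "set cs = S - {c} - H" "distinct cs"
      using b by (auto simp: history_arrivals_def permutations_of_set_def)
    then have "set (cs @ [c]) = S - H" "distinct (cs @ [c])" by auto
    then show "(case b of (c, H, cs) \<Rightarrow> (H, cs @ [c])) \<in> history_arrivals h S"
      using * by (auto simp: history_arrivals_def permutations_of_set_def)
    show "(case case b of (c, H, cs) \<Rightarrow> (H, cs @ [c]) of (H, cs) \<Rightarrow> (last cs, H, butlast cs)) = b"
      by simp
    show "(case case b of (c, H, cs) \<Rightarrow> (H, cs @ [c]) of (H, cs) \<Rightarrow> g H cs) =
        (case b of (c, H, cs) \<Rightarrow> g H (cs @ [c]))"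
      by simp
  qed
  finally show ?thesis ..
qed

section \<open>Averages over subsets of a fixed size\<close>

abbreviation n_subsets :: "nat \<Rightarrow> 'a set \<Rightarrow> 'a set set" where
  "n_subsets n S \<equiv> {Y. Y \<subseteq> S \<and> card Y = n}"

definition mean_max :: "nat \<Rightarrow> ('a::linorder \<Rightarrow> real) \<Rightarrow> 'a set \<Rightarrow> real" where
  "mean_max n f S = (\<Sum>Y\<in>n_subsets n S. f (Max Y)) / real (card S choose n)"

text \<open>Double counting: each \<open>n\<close>-subset \<open>Y\<close> occurs once for every
  \<open>c\<close> outside \<open>Y\<close>, that is, \<open>card S - n\<close> times.\<close>

lemma sum_subsets_remove:
  fixes g :: "'a set \<Rightarrow> real"
  assumes "finite S"
  shows "(\<Sum>c\<in>S. \<Sum>Y\<in>n_subsets n (S - {c}). g Y) =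
    real (card S - n) * (\<Sum>Y\<in>n_subsets n S. g Y)"
proof -
  have "(\<Sum>c\<in>S. \<Sum>Y\<in>n_subsets n (S - {c}). g Y) =
      (\<Sum>c\<in>S. \<Sum>Y\<in>{Y \<in> n_subsets n S. c \<notin> Y}. g Y)"
    by (intro sum.cong) auto
  also have "\<dots> = (\<Sum>Y\<in>n_subsets n S. \<Sum>c\<in>{c \<in> S. c \<notin> Y}. g Y)"
    using assms by (intro sum.swap_restrict) auto
  also have "\<dots> = (\<Sum>Y\<in>n_subsets n S. real (card S - n) * g Y)"
  proof (intro sum.cong refl)
    fix Y assume "Y \<in> n_subsets n S"
    moreover have "{c \<in> S. c \<notin> Y} = S - Y" by auto
    ultimately show "(\<Sum>c\<in>{c \<in> S. c \<notin> Y}. g Y) = real (card S - n) * g Y"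
      using assms by (simp add: card_Diff_finite_subset)
  qed
  finally show ?thesis by (simp add: sum_distrib_left)
qed

text \<open>Deleting a uniformly random element of \<open>S\<close> and then drawing a uniform
  \<open>n\<close>-subset of the rest gives a uniform \<open>n\<close>-subset of \<open>S\<close>.
  With \<open>n < card S\<close> such subsets exist after the deletion, so no denominator
  vanishes.\<close>

lemma sum_mean_max_remove:
  assumes "finite S" and "n < card S"
  shows "(\<Sum>c\<in>S. mean_max n f (S - {c})) = real (card S) * mean_max n f S"
proof -
  obtain m where m: "card S = Suc m" using assms by (cases "card S") auto
  have binom: "real (card S - n) * real (card S choose n) = real (card S) * real (m choose n)"
    using binomial_absorb_comp[of "card S" n] m
    by (metis diff_Suc_1 of_nat_mult)
  have pos: "real (m choose n) \<noteq> 0" "real (card S choose n) \<noteq> 0"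
    using assms m by simp_all
  have ratio: "real (card S - n) / real (m choose n) = real (card S) / real (card S choose n)"
    using frac_eq_eq[OF pos] binom by blast
  have "(\<Sum>c\<in>S. mean_max n f (S - {c})) =
      (\<Sum>c\<in>S. \<Sum>Y\<in>n_subsets n (S - {c}). f (Max Y)) / real (m choose n)"
    using assms m by (simp add: mean_max_def sum_divide_distrib)
  also have "\<dots> = real (card S - n) * (\<Sum>Y\<in>n_subsets n S. f (Max Y)) / real (m choose n)"
    using assms by (simp only: sum_subsets_remove)
  also have "\<dots> = real (card S) * mean_max n f S"
    by (simp only: times_divide_eq_left[symmetric] ratio) (simp add: mean_max_def)
  finally show ?thesis .
qed

section \<open>Acceptance in a single round\<close>

definition accept_prob :: "nat \<Rightarrow> 'a::linorder set \<Rightarrow> 'a \<Rightarrow> real" where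
  "accept_prob n T c =
     real (card {X \<in> n_subsets (n - 1) T. X = {} \<or> c > Max X}) / real (card T choose (n - 1))"

text \<open>The decision depends on history and past only through their union \<open>T\<close>; this
  is what decouples a round from the order of the earlier ones. The bound on \<open>card T\<close>
  makes the family of samples nonempty, so that \<open>pmf_of_set\<close> is the uniform
  distribution.\<close>

lemma pmf_algorithm3_True:
  assumes "finite T" and "n - 1 \<le> card T" and T: "T = H \<union> set past"
  shows "pmf (algorithm3 n H past c) True = accept_prob n T c"
proof -
  have card: "card (n_subsets (n - 1) T) = card T choose (n - 1)"
    using assms(1) by (rule n_subsets)
  have ne: "n_subsets (n - 1) T \<noteq> {}"
    using card assms(2) by (metis binomial_eq_0_iff card.empty not_less)
  have "pmf (algorithm3 n H past c) True =
    measure_pmf.prob (pmf_of_set (n_subsets (n - 1) T)) {X. X = {} \<or> c > Max X}"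
    unfolding algorithm3_def T pmf_map by (simp add: vimage_def)
  also have "\<dots> = accept_prob n T c"
    using assms(1) ne card
    by (subst measure_pmf_of_set) (auto simp: accept_prob_def Int_def)
  finally show ?thesis .
qed

text \<open>Pairs of a candidate \<open>c\<close> and a sample \<open>X\<close> that it beats
  correspond to \<open>n\<close>-subsets \<open>Y\<close> of \<open>S\<close>: join \<open>c\<close>
  to \<open>X\<close>, or split off \<open>Max Y\<close>. The constant payoff 1 shows that a round
  accepts with average probability \<open>1 / n\<close>.\<close>

lemma sum_accept_prob:
  assumes "finite S" and "1 \<le> n" and "n \<le> card S"
  shows "(\<Sum>c\<in>S. accept_prob n (S - {c}) c * f c) = real (card S) / real n * mean_max n f S"
proof -
  obtain m where m: "card S = Suc m" using assms by (cases "card S") auto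
  obtain k where k: "n = Suc k" using assms by (cases n) auto
  let ?B = "\<lambda>c. {X \<in> n_subsets k (S - {c}). X = {} \<or> c > Max X}"
  have "(\<Sum>c\<in>S. real (card (?B c)) * f c) = (\<Sum>c\<in>S. \<Sum>X\<in>?B c. f c)"
    by simp
  also have "\<dots> = (\<Sum>(c, X)\<in>Sigma S ?B. f c)"
    using assms by (subst sum.Sigma) (auto simp: split_def)
  also have "\<dots> = (\<Sum>Y\<in>n_subsets n S. f (Max Y))"
  proof (rule sum.reindex_bij_witness[of _ "\<lambda>Y. (Max Y, Y - {Max Y})" "\<lambda>(c, X). insert c X"])
    fix a assume a: "a \<in> Sigma S ?B"
    obtain c X where [simp]: "a = (c, X)" by (cases a)
    have X: "finite X" "c \<notin> X" "card X = k" "c \<in> S" "X \<subseteq> S" "X = {} \<or> c > Max X"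
      using a assms(1) by (auto intro: finite_subset)
    have max: "Max (insert c X) = c"
      using X by (cases "X = {}") (auto intro!: Max_eqI less_imp_le)
    show "(Max (case a of (c, X) \<Rightarrow> insert c X),
        (case a of (c, X) \<Rightarrow> insert c X) - {Max (case a of (c, X) \<Rightarrow> insert c X)}) = a"
      using X max by auto
    show "(case a of (c, X) \<Rightarrow> insert c X) \<in> n_subsets n S"
      using X k by auto
    show "f (Max (case a of (c, X) \<Rightarrow> insert c X)) = (case a of (c, X) \<Rightarrow> f c)"
      using max by simp
  next
    fix Y assume Y: "Y \<in> n_subsets n S"
    have fin: "finite Y" "Y \<noteq> {}" using Y assms k by (auto intro: finite_subset)
    then have mem: "Max Y \<in> Y" by simp
    then show "(case (Max Y, Y - {Max Y}) of (c, X) \<Rightarrow> insert c X) = Y" by auto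
    \<comment> \<open>The remainder is empty exactly when \<open>n = 1\<close>, the case covered by
      the disjunct \<open>X = {}\<close>.\<close>
    have less: "Max (Y - {Max Y}) < Max Y" if "Y - {Max Y} \<noteq> {}"
    proof -
      have "Max (Y - {Max Y}) \<in> Y - {Max Y}" using that fin by (intro Max_in) auto
      then show ?thesis using Max_ge[OF fin(1), of "Max (Y - {Max Y})"] by auto
    qed
    have "Max Y \<in> S"
      using Y mem by blast
    moreover have "Y - {Max Y} \<in> n_subsets k (S - {Max Y})"
      using Y mem k fin by auto
    ultimately show "(Max Y, Y - {Max Y}) \<in> Sigma S ?B"
      using less by blast
  qed
  finally have count: "(\<Sum>c\<in>S. real (card (?B c)) * f c) = (\<Sum>Y\<in>n_subsets n S. f (Max Y))" .
  \<comment> \<open>The absorption identity converts the number of samples per candidate into the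
    number of \<open>n\<close>-subsets.\<close>
  have binom: "real n * real (card S choose n) = real (card S) * real (m choose k)"
    unfolding of_nat_mult[symmetric]
    using binomial_absorption[of k "card S"] m k by (simp only: diff_Suc_1)
  have pos: "real (m choose k) > 0" "real (card S choose n) > 0"
    using assms m k by (simp_all del: binomial_Suc_Suc)
  have "(\<Sum>c\<in>S. accept_prob n (S - {c}) c * f c) =
      (\<Sum>c\<in>S. real (card (?B c)) * f c) / real (m choose k)"
    using assms m k by (simp add: accept_prob_def sum_divide_distrib)
  also have "\<dots> = real (card S) / real n * mean_max n f S"
    using binom pos k unfolding count mean_max_def by (simp add: field_simps)
  finally show ?thesis .
qed

section \<open>Induction on the number of arrivals: survival and collected value\<close>

lemma mean_max_const:
  assumes "finite S" and "n \<le> card S"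
  shows "mean_max n (\<lambda>_. a) S = a"
  using assms n_subsets[OF assms(1), of n] by (simp add: mean_max_def)

text \<open>When \<open>c\<close> arrives last, history and earlier arrivals together exhaust
  \<open>S - {c}\<close>. Its acceptance probability is therefore the same for all these runs and
  leaves the inner sum.\<close>

lemma sum_run_from_algorithm3_snoc:
  fixes f :: "('l::linorder) candidate option \<Rightarrow> real"
  assumes "finite S" and "h < card S" and "1 \<le> n" and "n \<le> h"
  shows "(\<Sum>(H, cs)\<in>history_arrivals h S. measure_pmf.expectation (run_from algorithm3 n H [] cs) f) =
    (\<Sum>c\<in>S. (\<Sum>(H, cs)\<in>history_arrivals h (S - {c}).
        measure_pmf.expectation (run_from algorithm3 n H [] cs) f)
      + (\<Sum>(H, cs)\<in>history_arrivals h (S - {c}). pmf (run_from algorithm3 n H [] cs) None)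
        * (accept_prob n (S - {c}) c * (f (Some c) - f None)))"
  unfolding sum_history_arrivals_snoc[OF assms(1,2)] sum_distrib_right sum.distrib[symmetric]
proof (intro sum.cong refl)
  fix c x assume c: "c \<in> S" and x: "x \<in> history_arrivals h (S - {c})"
  obtain H cs where [simp]: "x = (H, cs)" by (cases x)
  have "S - {c} = H \<union> set ([] @ cs)"
    using x by (auto simp: history_arrivals_def permutations_of_set_def)
  moreover have "finite (S - {c})" "n - 1 \<le> card (S - {c})"
    using assms c by simp_all
  ultimately have "pmf (algorithm3 n H ([] @ cs) c) True = accept_prob n (S - {c}) c"
    by (intro pmf_algorithm3_True)
  then show "(case x of (H, cs) \<Rightarrow>
        measure_pmf.expectation (run_from algorithm3 n H [] (cs @ [c])) f) =
      (case x of (H, cs) \<Rightarrow> measure_pmf.expectation (run_from algorithm3 n H [] cs) f)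
      + (case x of (H, cs) \<Rightarrow> pmf (run_from algorithm3 n H [] cs) None)
        * (accept_prob n (S - {c}) c * (f (Some c) - f None))"
    by (simp add: expectation_run_from_snoc)
qed

text \<open>The quotient of factorials counts the runs, and each of the \<open>k\<close> rounds is
  survived with a factor \<open>1 - 1 / n\<close>. By induction the survival sum is the same for
  every last arrival \<open>c\<close>, so only the total of the acceptance probabilities over
  \<open>c\<close> enters.\<close>

lemma sum_pmf_run_from_algorithm3_None:
  fixes S :: "('l::linorder) candidate set"
  assumes "finite S" and "card S = h + k" and "1 \<le> n" and "n \<le> h"
  shows "(\<Sum>(H, cs)\<in>history_arrivals h S. pmf (run_from algorithm3 n H [] cs) None) =
    fact (h + k) / fact h * (1 - 1 / real n) ^ k"
  using assms(1,2)
proof (induction k arbitrary: S)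
  case 0
  then show ?case using history_arrivals_self[of S] by simp
next
  case (Suc k)
  let ?R = "\<lambda>S. \<Sum>(H, cs)\<in>history_arrivals h S. pmf (run_from algorithm3 n H [] cs) None"
  let ?a = "fact (h + k) / fact h * (1 - 1 / real n) ^ k"
  have IH: "?R (S - {c}) = ?a" if "c \<in> S" for c
    using Suc that by simp
  \<comment> \<open>For the payoff \<open>indicator {None}\<close> the gain
    \<open>f (Some c) - f None\<close> is \<open>- 1\<close>.\<close>
  have "?R S = (\<Sum>c\<in>S. ?R (S - {c}) + ?R (S - {c}) * (accept_prob n (S - {c}) c * (- 1)))"
    using sum_run_from_algorithm3_snoc[of S h n "indicator {None}"] Suc.prems assms(3,4)
    by (simp add: measure_pmf_single)
  \<comment> \<open>The factor \<open>* 1\<close> brings the sum into the shape of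
    \<open>sum_accept_prob\<close> with constant payoff 1.\<close>
  also have "\<dots> = (\<Sum>c\<in>S. ?a * (1 - accept_prob n (S - {c}) c * 1))"
    by (intro sum.cong refl) (simp add: IH right_diff_distrib)
  also have "\<dots> = ?a * (real (card S) - (\<Sum>c\<in>S. accept_prob n (S - {c}) c * 1))"
    by (simp only: sum_distrib_left[symmetric] sum_subtractf) simp
  also have "\<dots> = ?a * (real (card S) * (1 - 1 / real n))"
  proof -
    have "(\<Sum>c\<in>S. accept_prob n (S - {c}) c * 1) = real (card S) / real n"
      using Suc.prems assms(3,4) by (subst sum_accept_prob) (simp_all add: mean_max_const)
    then show ?thesis
      by (simp only: right_diff_distrib times_divide_eq_right mult_1_right)
  qed
  also have "\<dots> = fact (h + Suc k) / fact h * (1 - 1 / real n) ^ Suc k"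
    using Suc.prems by simp
  finally show ?case .
qed

text \<open>The earlier rounds contribute multiples of \<open>mean_max n val (S - {c})\<close>,
  which average over \<open>c\<close> to \<open>mean_max n val S\<close>; the last round contributes
  a multiple of the same quantity. Only the coefficients have to be added.\<close>

lemma sum_value_run_from_algorithm3:
  fixes S :: "('l::linorder) candidate set"
  assumes "finite S" and "card S = h + k" and "1 \<le> n" and "n \<le> h"
  shows "(\<Sum>(H, cs)\<in>history_arrivals h S.
      measure_pmf.expectation (run_from algorithm3 n H [] cs) (case_option 0 val)) =
    fact (h + k) / fact h * (1 - (1 - 1 / real n) ^ k) * mean_max n val S"
  using assms(1,2)
proof (induction k arbitrary: S)
  case 0
  then show ?case using history_arrivals_self[of S] by simp
next
  case (Suc k)
  let ?V = "\<lambda>S. \<Sum>(H, cs)\<in>history_arrivals h S.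
      measure_pmf.expectation (run_from algorithm3 n H [] cs) (case_option 0 val)"
  let ?a = "fact (h + k) / fact h :: real" and ?q = "1 - 1 / real n"
  have IH: "?V (S - {c}) = ?a * (1 - ?q ^ k) * mean_max n val (S - {c})" if "c \<in> S" for c
    using Suc that by simp
  have R: "(\<Sum>(H, cs)\<in>history_arrivals h (S - {c}). pmf (run_from algorithm3 n H [] cs) None) =
      ?a * ?q ^ k" if "c \<in> S" for c
    using Suc.prems that assms(3,4) by (intro sum_pmf_run_from_algorithm3_None) auto
  have "?V S = (\<Sum>c\<in>S. ?a * (1 - ?q ^ k) * mean_max n val (S - {c})
      + ?a * ?q ^ k * (accept_prob n (S - {c}) c * val c))"
    using Suc.prems assms(3,4)
    by (subst sum_run_from_algorithm3_snoc) (simp_all add: IH R cong: sum.cong)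
  also have "\<dots> = ?a * (1 - ?q ^ k) * (\<Sum>c\<in>S. mean_max n val (S - {c}))
      + ?a * ?q ^ k * (\<Sum>c\<in>S. accept_prob n (S - {c}) c * val c)"
    by (simp only: sum.distrib sum_distrib_left)
  also have "\<dots> = ?a * (1 - ?q ^ k) * (real (card S) * mean_max n val S)
      + ?a * ?q ^ k * (real (card S) / real n * mean_max n val S)"
    using Suc.prems assms(3,4) by (simp add: sum_mean_max_remove sum_accept_prob)
  \<comment> \<open>Since \<open>1 / n = 1 - ?q\<close>, the coefficients \<open>1 - ?q ^ k\<close>
    and \<open>?q ^ k / n\<close> add up to \<open>1 - ?q ^ Suc k\<close>.\<close>
  also have "\<dots> = (?a * real (card S)) * (1 - ?q ^ Suc k) * mean_max n val S"
    by (simp add: algebra_simps)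
  also have "?a * real (card S) = fact (h + Suc k) / fact h"
    using Suc.prems by simp
  finally show ?case .
qed

section \<open>Optimum and performance as normalized sums\<close>

lemma val_mono: "c \<le> d \<Longrightarrow> val c \<le> val (d :: ('l::linorder) candidate)"
  by (auto simp: less_eq_candidate_def)

text \<open>The complement of a uniform \<open>h\<close>-subset of \<open>C\<close> is a uniform
  \<open>n\<close>-subset, so the optimum has the law of the quantity that the algorithm
  samples.\<close>

lemma expected_OPT_eq_mean_max:
  fixes C :: "('l::linorder) candidate set"
  assumes "finite C" and "card C = n + h" and "1 \<le> n"
  shows "expected_OPT h C = mean_max n val C"
proof -
  have card: "card (n_subsets h C) = card C choose h"
    using assms(1) by (rule n_subsets)
  have ne: "n_subsets h C \<noteq> {}"
    using card assms(2) by (metis binomial_eq_0_iff card.empty le_add2 not_less)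
  have "expected_OPT h C = (\<Sum>H\<in>n_subsets h C. Max (val ` (C - H))) / real (card C choose h)"
    using assms(1) ne card by (simp add: expected_OPT_def history_pmf_def integral_pmf_of_set)
  also have "(\<Sum>H\<in>n_subsets h C. Max (val ` (C - H))) = (\<Sum>Y\<in>n_subsets n C. val (Max Y))"
  proof (rule sum.reindex_bij_witness[of _ "\<lambda>Y. C - Y" "\<lambda>H. C - H"])
    fix H assume H: "H \<in> n_subsets h C"
    then have c: "card (C - H) = n"
      using assms by (simp add: card_Diff_finite_subset)
    then show "C - H \<in> n_subsets n C" by auto
    have "C - H \<noteq> {}" using c assms(3) by (metis card.empty not_one_le_zero)
    \<comment> \<open>Ties in value are harmless: \<open>val\<close> is monotone in the candidate
      order and hence commutes with \<open>Max\<close>.\<close>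
    then show "val (Max (C - H)) = Max (val ` (C - H))"
      using assms(1) by (intro mono_Max_commute) (auto intro: monoI val_mono)
  qed (use assms in \<open>auto simp: card_Diff_finite_subset\<close>)
  also have "card C choose h = card C choose n"
    using assms(2) binomial_symmetric[of n "card C"] by simp
  finally show ?thesis by (simp add: mean_max_def)
qed

text \<open>All histories leave \<open>n\<close> arrivals, so every pair of history and order has
  the same weight, the reciprocal of \<open>fact n * (card C choose h)\<close>.\<close>

lemma expected_ALG_eq_sum:
  fixes C :: "'l candidate set"
  assumes "finite C" and "card C = n + h"
  shows "expected_ALG A n h C =
    (\<Sum>(H, cs)\<in>history_arrivals h C.
      measure_pmf.expectation (run_from A n H [] cs) (case_option 0 val)) * fact h / fact (h + n)"
proof -
  let ?E = "\<lambda>H cs. measure_pmf.expectation (run_from A n H [] cs) (case_option 0 val)"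
  have card: "card (n_subsets h C) = card C choose h"
    using assms(1) by (rule n_subsets)
  have ne: "n_subsets h C \<noteq> {}"
    using card assms(2) by (metis binomial_eq_0_iff card.empty le_add2 not_less)
  have inner: "measure_pmf.expectation
      (bind_pmf (pmf_of_set (permutations_of_set (C - H))) (run_from A n H [])) (case_option 0 val) =
      (\<Sum>cs\<in>permutations_of_set (C - H). ?E H cs) / fact n" if "H \<in> n_subsets h C" for H
  proof -
    have "card (C - H) = n"
      using that assms by (simp add: card_Diff_finite_subset)
    then show ?thesis
      using assms(1)
      by (subst pmf_expectation_bind_pmf_of_set)
         (simp_all add: finite_set_run_from sum_distrib_left divide_inverse mult.commute)
  qed
  have "expected_ALG A n h C = (\<Sum>H\<in>n_subsets h C. measure_pmf.expectation
      (bind_pmf (pmf_of_set (permutations_of_set (C - H))) (run_from A n H [])) (case_option 0 val)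
      / real (card C choose h))"
    unfolding expected_ALG_def outcome_pmf_def history_pmf_def
    using assms(1) ne
    by (subst pmf_expectation_bind_pmf_of_set)
       (auto simp: card finite_set_run_from divide_inverse mult.commute)
  also have "\<dots> = (\<Sum>H\<in>n_subsets h C. \<Sum>cs\<in>permutations_of_set (C - H). ?E H cs)
      / (fact n * real (card C choose h))"
    unfolding sum_divide_distrib
    by (intro sum.cong refl) (simp only: inner, simp add: sum_divide_distrib)
  also have "(\<Sum>H\<in>n_subsets h C. \<Sum>cs\<in>permutations_of_set (C - H). ?E H cs) =
      (\<Sum>(H, cs)\<in>history_arrivals h C. ?E H cs)"
    using assms(1) unfolding history_arrivals_def by (subst sum.Sigma) auto
  also have "fact n * real (card C choose h) = fact (h + n) / fact h"
    using assms(2) by (simp add: binomial_fact add.commute)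
  finally show ?thesis by simp
qed

theorem theorem6:
  fixes n h :: nat
  assumes "n \<ge> 1" and "h \<ge> n"
  shows "competitive n h (1 - (1 - 1 / real n) ^ n) (algorithm3 :: ('l::linorder) online_algorithm)"
proof -
  \<comment> \<open>For \<open>k = n\<close> the number of runs cancels against the weight of a run,
    and the ratio is attained with equality.\<close>
  have "expected_ALG algorithm3 n h C = (1 - (1 - 1 / real n) ^ n) * expected_OPT h C"
    if "finite C" "card C = n + h" for C :: "'l candidate set"
    using that assms
    by (simp add: expected_ALG_eq_sum sum_value_run_from_algorithm3[where k = n]
        expected_OPT_eq_mean_max add.commute)
  then show ?thesis
    by (simp add: competitive_def)
qed

end
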